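(* Let $I\subseteq\mathbb{R}$ be a non-degenerate interval, and let $f$ be a continuous real-valued function on $I$ such that $f(x)>0$ for all $x\in I$. If $pf(php)p\le f(h)$ for all projections $p$ and all self-adjoint operators $h$ with spectrum in $I$ (with $p,h$ acting on the same Hilbert space), then $-1/f$ is operator convex on $I$.
   Context: Operators are bounded operators on (arbitrary, complex) Hilbert spaces (they may be assumed to be finite matrices); for a self-adjoint operator $h$ with spectrum in $I$ and a continuous function $f$ on $I$, $f(h)$ is defined by the continuous functional calculus; $\le$ is the usual order on self-adjoint operators. Projection means self-adjoint idempotent. For a projection $p$ and a self-adjoint $h$ on a Hilbert space $H$ with spectrum in $I$, $pf(php)p$ denotes the operator which on the range $pH$ of $p$ equals $f$ applied to the compression of $h$ to $pH$ (a self-adjoint operator on $pH$ with spectrum in $I$), and which is $0$ on $(1-p)H$; thus it makes sense even when $0\notin I$. A continuous real-valued function $g$ on $I$ is operator convex if $g(th_1+(1-t)h_2)\le tg(h_1)+(1-t)g(h_2)$ for all $0\le t\le 1$ and all self-adjoint $h_1,h_2$ (on the same Hilbert space) with spectra in $I$. *)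

theory Defs
  imports
    "HOL-Analysis.Topology_Euclidean_Space"
    "Jordan_Normal_Form.Spectral_Radius"
begin

text \<open>
  Operators are complex \<open>n \<times> n\<close> matrices, with \<open>n\<close> ranging over all natural numbers, acting on
  the Hilbert space \<open>carrier_vec n\<close> with inner product \<open>\<bullet>c\<close>.
\<close>

definition self_adjoint_mat :: "nat \<Rightarrow> complex mat \<Rightarrow> bool" where
  "self_adjoint_mat n h \<longleftrightarrow> h \<in> carrier_mat n n \<and> mat_adjoint h = h"

definition projection_mat :: "nat \<Rightarrow> complex mat \<Rightarrow> bool" where
  "projection_mat n p \<longleftrightarrow> self_adjoint_mat n p \<and> p * p = p"

definition unitary_mat :: "nat \<Rightarrow> complex mat \<Rightarrow> bool" where
  "unitary_mat n U \<longleftrightarrow>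
     U \<in> carrier_mat n n \<and> mat_adjoint U * U = 1\<^sub>m n \<and> U * mat_adjoint U = 1\<^sub>m n"

definition spectrum_in :: "complex mat \<Rightarrow> real set \<Rightarrow> bool" where
  "spectrum_in h I \<longleftrightarrow> spectrum h \<subseteq> complex_of_real ` I"

text \<open>
  The order on complex numbers is that of \<^theory>\<open>HOL-Library.Complex_Order\<close>: \<open>0 \<le> z\<close> means that
  \<open>z\<close> is real and nonnegative.
\<close>

definition mat_le :: "nat \<Rightarrow> complex mat \<Rightarrow> complex mat \<Rightarrow> bool" where
  "mat_le n A B \<longleftrightarrow> (\<forall>v \<in> carrier_vec n. 0 \<le> ((B - A) *\<^sub>v v) \<bullet>c v)"

text \<open>
  \<open>is_mat_fun f h B\<close>: if \<open>h = U diag(d) U\<^sup>*\<close> with \<open>U\<close> unitary and \<open>d\<close> real, then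
  \<open>B = U diag(f d) U\<^sup>*\<close>. For self-adjoint \<open>h\<close> there is exactly one such \<open>B\<close>, and it depends only
  on the values of \<open>f\<close> on the spectrum of \<open>h\<close>.
\<close>

definition is_mat_fun :: "(real \<Rightarrow> real) \<Rightarrow> complex mat \<Rightarrow> complex mat \<Rightarrow> bool" where
  "is_mat_fun f h B \<longleftrightarrow>
     (\<exists>U d. unitary_mat (dim_row h) U
        \<and> h = U * mat_diag (dim_row h) (\<lambda>i. complex_of_real (d i)) * mat_adjoint U
        \<and> B = U * mat_diag (dim_row h) (\<lambda>i. complex_of_real (f (d i))) * mat_adjoint U)"

definition mat_fun :: "(real \<Rightarrow> real) \<Rightarrow> complex mat \<Rightarrow> complex mat" where
  "mat_fun f h = (THE B. is_mat_fun f h B)"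

text \<open>
  The operator \<open>p f(php) p\<close>. The columns of \<open>V\<close> form an orthonormal basis of the range of \<open>p\<close>, which
  identifies the range with \<open>carrier_vec k\<close>; then \<open>V\<^sup>* h V\<close> is the compression of \<open>h\<close> to the range,
  and \<open>V X V\<^sup>*\<close> is the operator that acts as \<open>X\<close> on the range and vanishes on its orthogonal
  complement. The result does not depend on the choice of \<open>V\<close>.
\<close>

definition is_compressed_fun ::
    "(real \<Rightarrow> real) \<Rightarrow> complex mat \<Rightarrow> complex mat \<Rightarrow> complex mat \<Rightarrow> bool" where
  "is_compressed_fun f p h B \<longleftrightarrow>
     (\<exists>k V. V \<in> carrier_mat (dim_row p) k
        \<and> mat_adjoint V * V = 1\<^sub>m k \<and> V * mat_adjoint V = p
        \<and> B = V * mat_fun f (mat_adjoint V * h * V) * mat_adjoint V)"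

definition compressed_fun ::
    "(real \<Rightarrow> real) \<Rightarrow> complex mat \<Rightarrow> complex mat \<Rightarrow> complex mat" where
  "compressed_fun f p h = (THE B. is_compressed_fun f p h B)"

definition operator_convex_on :: "real set \<Rightarrow> (real \<Rightarrow> real) \<Rightarrow> bool" where
  "operator_convex_on I g \<longleftrightarrow> continuous_on I g \<and>
     (\<forall>n h\<^sub>1 h\<^sub>2. \<forall>t::real. 0 \<le> t \<and> t \<le> 1
        \<and> self_adjoint_mat n h\<^sub>1 \<and> spectrum_in h\<^sub>1 I
        \<and> self_adjoint_mat n h\<^sub>2 \<and> spectrum_in h\<^sub>2 I \<longrightarrow>
        mat_le n
          (mat_fun g (complex_of_real t \<cdot>\<^sub>m h\<^sub>1 + complex_of_real (1 - t) \<cdot>\<^sub>m h\<^sub>2))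
          (complex_of_real t \<cdot>\<^sub>m mat_fun g h\<^sub>1 + complex_of_real (1 - t) \<cdot>\<^sub>m mat_fun g h\<^sub>2))"

end

theory Submission
  imports Defs "HOL-Analysis.Convex_Euclidean_Space"
begin

text \<open>
  The idea is to read a convex combination as a compression, and to observe that inversion turns the
  hypothesis around. For \<open>0 \<le> t \<le> 1\<close> the operator \<open>V v = (\<surd>t v, \<surd>(1 - t) v)\<close> is an isometry from
  \<open>\<complex>\<^sup>n\<close> into \<open>\<complex>\<^sup>n \<oplus> \<complex>\<^sup>n\<close>, and \<open>V\<^sup>* (X \<oplus> Y) V = t X + (1 - t) Y\<close> for all \<open>X\<close>, \<open>Y\<close>
  (\<open>convex_isometry_compression\<close>). With \<open>h = h\<^sub>1 \<oplus> h\<^sub>2\<close>, the compression of \<open>h\<close> to the range of the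
  projection \<open>V V\<^sup>*\<close> is therefore \<open>k = t h\<^sub>1 + (1 - t) h\<^sub>2\<close>, and the hypothesis says
  \<open>V f(k) V\<^sup>* \<le> f(h)\<close>. For positive invertible \<open>A = f(k)\<close> and \<open>F = f(h)\<close>, the inequality
  \<open>V A V\<^sup>* \<le> F\<close> implies \<open>V\<^sup>* F\<^sup>-\<^sup>1 V \<le> A\<^sup>-\<^sup>1\<close> (\<open>mat_le_inverse_compression\<close>). Since
  \<open>F\<^sup>-\<^sup>1 = (1/f)(h\<^sub>1) \<oplus> (1/f)(h\<^sub>2)\<close>, this reads
  \<open>t (1/f)(h\<^sub>1) + (1 - t) (1/f)(h\<^sub>2) \<le> (1/f)(k)\<close>, the operator convexity of \<open>-1/f\<close>.

  The argument presupposes the finite-dimensional functional calculus. Existence of \<open>f(h)\<close> is the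
  spectral theorem, by deflating one eigenvector at a time (\<open>spectral_theorem\<close>). Uniqueness of \<open>f(h)\<close>
  and of \<open>p f(php) p\<close> have a common source (\<open>spectral_mat_intertwine\<close>): an operator \<open>S\<close> with
  \<open>X S = S Y\<close> satisfies \<open>f(X) S = S f(Y)\<close>. The interval enters through \<open>spectrum_in_compression\<close>:
  eigenvalues of a compression are convex combinations of eigenvalues of the original operator.
\<close>

(* The dollar sign below always selects an entry of a carrier-based vector. *)
unbundle no vec_syntax

section \<open>Adjoints\<close>

lemma dim_mat_adjoint [simp]:
  "dim_row (mat_adjoint A) = dim_col A" "dim_col (mat_adjoint A) = dim_row A"
  by (simp_all add: mat_adjoint_def)

lemma mat_adjoint_carrier [simp]:
  "A \<in> carrier_mat n m \<Longrightarrow> mat_adjoint A \<in> carrier_mat m n"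
  unfolding carrier_mat_def by simp

lemma index_mat_adjoint [simp]:
  "i < dim_col A \<Longrightarrow> j < dim_row A \<Longrightarrow> mat_adjoint A $$ (i, j) = conjugate (A $$ (j, i))"
  by (simp add: mat_adjoint_def mat_of_rows_index)

lemma mat_adjoint_adjoint [simp]: "mat_adjoint (mat_adjoint A) = A"
  by (rule eq_matI) auto

lemma mat_adjoint_mult [simp]:
  "dim_col A = dim_row B \<Longrightarrow> mat_adjoint (A * B) = mat_adjoint B * mat_adjoint A"
  by (rule eq_matI) (auto simp: scalar_prod_def sum_conjugate conjugate_dist_mul mult.commute)

lemma mat_adjoint_minus:
  fixes A B :: "complex mat"
  assumes "A \<in> carrier_mat n m" "B \<in> carrier_mat n m"
  shows "mat_adjoint (A - B) = mat_adjoint A - mat_adjoint B"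
  using assms by (intro eq_matI) auto

lemma mat_adjoint_real_diag [simp]:
  "mat_adjoint (mat_diag n (\<lambda>i. complex_of_real (d i))) = mat_diag n (\<lambda>i. complex_of_real (d i))"
  by (rule eq_matI) (auto simp: mat_diag_def)

lemma mat_adjoint_one [simp]: "mat_adjoint (1\<^sub>m n :: complex mat) = 1\<^sub>m n"
  by (rule eq_matI) auto

lemma mat_adjoint_zero [simp]: "mat_adjoint (0\<^sub>m n m :: complex mat) = 0\<^sub>m m n"
  by (rule eq_matI) auto

lemma mat_adjoint_smult [simp]:
  "mat_adjoint (c \<cdot>\<^sub>m A) = conjugate c \<cdot>\<^sub>m mat_adjoint A"
  by (rule eq_matI) (auto simp: conjugate_dist_mul)

lemma mat_adjoint_four_block:
  assumes "A \<in> carrier_mat nr1 nc1" "B \<in> carrier_mat nr1 nc2"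
    "C \<in> carrier_mat nr2 nc1" "D \<in> carrier_mat nr2 nc2"
  shows "mat_adjoint (four_block_mat A B C D)
    = four_block_mat (mat_adjoint A) (mat_adjoint C) (mat_adjoint B) (mat_adjoint D)"
  using assms by (intro eq_matI) auto

lemma dim_mat_diag [simp]: "dim_row (mat_diag n d) = n" "dim_col (mat_diag n d) = n"
  by (simp_all add: mat_diag_def)

text \<open>
  Associativity with equations between dimensions as side conditions, which rewriting can decide
  for rectangular factors; membership in \<open>carrier_mat\<close> would leave the dimensions to be guessed.
\<close>

lemma mat_mult_assoc_dim:
  "dim_col A = dim_row B \<Longrightarrow> dim_col B = dim_row C \<Longrightarrow> A * B * C = A * (B * (C :: complex mat))"
  by (rule assoc_mult_mat[of A "dim_row A" "dim_col A" B "dim_col B" C "dim_col C"]) auto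

text \<open>
  Once \<open>mat_mult_assoc_dim\<close> has associated a long product to the right, a pair \<open>P * Q\<close> with product
  \<open>1\<close> shows up as \<open>P * (Q * X)\<close>; this is the cancellation rule for that form.
\<close>

lemma mat_inverse_cancel:
  fixes P :: "complex mat"
  assumes "P * Q = 1\<^sub>m n" "dim_col P = dim_row Q" "dim_col Q = dim_row X" "dim_row X = n"
  shows "P * (Q * X) = X"
  using mat_mult_assoc_dim[of P Q X] assms by (metis carrier_matI left_mult_one_mat)

lemma mat_adjoint_inner:
  fixes A :: "complex mat"
  assumes A: "A \<in> carrier_mat n m" and x: "x \<in> carrier_vec n" and y: "y \<in> carrier_vec m"
  shows "(mat_adjoint A *\<^sub>v x) \<bullet>c y = x \<bullet>c (A *\<^sub>v y)"
proof -
  have "(mat_adjoint A *\<^sub>v x) \<bullet>c y = (\<Sum>i<m. \<Sum>j<n. cnj (A $$ (j, i)) * x $ j * cnj (y $ i))"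
    using assms by (simp add: scalar_prod_def sum_distrib_right atLeast0LessThan)
  also have "\<dots> = (\<Sum>j<n. \<Sum>i<m. cnj (A $$ (j, i)) * x $ j * cnj (y $ i))"
    by (rule sum.swap)
  also have "\<dots> = x \<bullet>c (A *\<^sub>v y)"
    using assms by (simp add: scalar_prod_def sum_distrib_left atLeast0LessThan ac_simps)
  finally show ?thesis .
qed

section \<open>Positive semidefinite matrices\<close>

definition psd_mat :: "nat \<Rightarrow> complex mat \<Rightarrow> bool" where
  "psd_mat n A \<longleftrightarrow> (\<forall>v \<in> carrier_vec n. 0 \<le> (A *\<^sub>v v) \<bullet>c v)"

lemma mat_le_iff_psd: "mat_le n A B \<longleftrightarrow> psd_mat n (B - A)"
  by (simp add: mat_le_def psd_mat_def)

lemma psd_mat_add: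
  assumes "A \<in> carrier_mat n n" "B \<in> carrier_mat n n" "psd_mat n A" "psd_mat n B"
  shows "psd_mat n (A + B)"
  using assms unfolding psd_mat_def
  by (auto simp: add_mult_distrib_mat_vec add_scalar_prod_distrib[of _ n])

lemma psd_mat_congruence:
  assumes A: "A \<in> carrier_mat n n" and Y: "Y \<in> carrier_mat n m" and "psd_mat n A"
  shows "psd_mat m (mat_adjoint Y * A * Y)"
  unfolding psd_mat_def
proof
  fix v :: "complex vec" assume v: "v \<in> carrier_vec m"
  have Yv: "Y *\<^sub>v v \<in> carrier_vec n" using Y v by simp
  have "(mat_adjoint Y * A * Y) *\<^sub>v v = mat_adjoint Y *\<^sub>v (A *\<^sub>v (Y *\<^sub>v v))"
    using A Y v Yv mat_adjoint_carrier[OF Y] mult_carrier_mat[OF mat_adjoint_carrier[OF Y] A]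
    by (simp add: assoc_mult_mat_vec[of _ m n])
  then have "((mat_adjoint Y * A * Y) *\<^sub>v v) \<bullet>c v = (A *\<^sub>v (Y *\<^sub>v v)) \<bullet>c (Y *\<^sub>v v)"
    using mat_adjoint_inner[OF Y _ v, of "A *\<^sub>v (Y *\<^sub>v v)"] A Yv by simp
  then show "0 \<le> ((mat_adjoint Y * A * Y) *\<^sub>v v) \<bullet>c v"
    using assms(3) Yv by (simp add: psd_mat_def)
qed

text \<open>
  The quadratic form of a real diagonal matrix is \<open>\<Sum>i. d\<^sub>i |v\<^sub>i|\<^sup>2\<close>.
\<close>

lemma psd_mat_diag:
  assumes "\<And>i. i < n \<Longrightarrow> 0 \<le> d i"
  shows "psd_mat n (mat_diag n (\<lambda>i. complex_of_real (d i)))"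
  unfolding psd_mat_def
proof
  fix v :: "complex vec" assume v: "v \<in> carrier_vec n"
  have Dv: "mat_diag n (\<lambda>i. complex_of_real (d i)) *\<^sub>v v = vec n (\<lambda>i. complex_of_real (d i) * v $ i)"
  proof (rule eq_vecI)
    fix i assume "i < dim_vec (vec n (\<lambda>i. complex_of_real (d i) * v $ i))"
    then have i: "i < n" by simp
    have "(mat_diag n (\<lambda>i. complex_of_real (d i)) *\<^sub>v v) $ i
        = (\<Sum>j<n. (if i = j then complex_of_real (d j) else 0) * v $ j)"
      using v i by (auto simp: mat_diag_def scalar_prod_def atLeast0LessThan intro!: sum.cong)
    also have "\<dots> = (\<Sum>j<n. if i = j then complex_of_real (d j) * v $ j else 0)"
      by (rule sum.cong) auto
    also have "\<dots> = complex_of_real (d i) * v $ i"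
      using i by simp
    finally show "(mat_diag n (\<lambda>i. complex_of_real (d i)) *\<^sub>v v) $ i
        = vec n (\<lambda>i. complex_of_real (d i) * v $ i) $ i" using i by simp
  qed simp
  have "(mat_diag n (\<lambda>i. complex_of_real (d i)) *\<^sub>v v) \<bullet>c v
      = (\<Sum>i<n. complex_of_real (d i * (cmod (v $ i))\<^sup>2))"
  proof -
    have "complex_of_real a * z * cnj z = complex_of_real (a * (cmod z)\<^sup>2)" for a z
      by (simp only: of_real_mult complex_norm_square mult.assoc)
    then show ?thesis
      using v by (simp add: scalar_prod_def atLeast0LessThan Dv del: of_real_mult of_real_power)
  qed
  also have "\<dots> = complex_of_real (\<Sum>i<n. d i * (cmod (v $ i))\<^sup>2)" by simp
  also have "0 \<le> \<dots>"
    unfolding less_eq_complex_def using assms by (auto intro!: sum_nonneg)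
  finally show "0 \<le> (mat_diag n (\<lambda>i. complex_of_real (d i)) *\<^sub>v v) \<bullet>c v" .
qed

text \<open>
  Inversion reverses the inequality \<open>V A V\<^sup>* \<le> F\<close>. With \<open>G = F\<^sup>-\<^sup>1\<close>, \<open>C = A\<^sup>-\<^sup>1\<close> and \<open>B = V\<^sup>* G V\<close>,
  completing the square gives
  \<open>C - B = (B - C)\<^sup>* A (B - C) + (G V)\<^sup>* (F - V A V\<^sup>*) (G V)\<close>:
  the first summand expands to \<open>B A B - 2 B + C\<close> and the second to \<open>B - B A B\<close>. Both summands are
  congruences of positive semidefinite matrices.
\<close>

lemma mat_le_inverse_compression:
  assumes V: "V \<in> carrier_mat m n" and F: "F \<in> carrier_mat m m" and G: "G \<in> carrier_mat m m"
    and A: "A \<in> carrier_mat n n" and C: "C \<in> carrier_mat n n"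
    and G_adj: "mat_adjoint G = G" and C_adj: "mat_adjoint C = C"
    and FG: "F * G = 1\<^sub>m m" and AC: "A * C = 1\<^sub>m n"
    and A_psd: "psd_mat n A" and le: "mat_le m (V * A * mat_adjoint V) F"
  shows "mat_le n (mat_adjoint V * G * V) C"
proof -
  define B where "B = mat_adjoint V * G * V"
  define D where "D = F - V * A * mat_adjoint V"
  have V': "mat_adjoint V \<in> carrier_mat n m" using V by simp
  have B: "B \<in> carrier_mat n n"
    unfolding B_def by (rule mult_carrier_mat[OF mult_carrier_mat[OF V' G] V])
  have GV: "G * V \<in> carrier_mat m n" using G V by simp
  have GV': "mat_adjoint (G * V) \<in> carrier_mat n m" using GV by (rule mat_adjoint_carrier)
  have VAV: "V * A * mat_adjoint V \<in> carrier_mat m m"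
    by (rule mult_carrier_mat[OF mult_carrier_mat[OF V A] V'])
  have D: "D \<in> carrier_mat m m"
    unfolding D_def by (rule minus_carrier_mat[OF VAV])
  note dims = V[THEN carrier_matD(1)] V[THEN carrier_matD(2)] F[THEN carrier_matD(1)]
    F[THEN carrier_matD(2)] G[THEN carrier_matD(1)] G[THEN carrier_matD(2)]
    A[THEN carrier_matD(1)] A[THEN carrier_matD(2)] C[THEN carrier_matD(1)] C[THEN carrier_matD(2)]
    B[THEN carrier_matD(1)] B[THEN carrier_matD(2)]
  have B_adj: "mat_adjoint B = B"
    using dims by (simp add: B_def G_adj mat_mult_assoc_dim)
  have CA: "C * A = 1\<^sub>m n" using mat_mult_left_right_inverse[OF A C AC] .
  have BC: "B - C \<in> carrier_mat n n" using minus_carrier_mat[OF C] .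
  have "mat_adjoint (B - C) * A * (B - C) = (B - C) * A * (B - C)"
    using B C by (simp add: mat_adjoint_minus B_adj C_adj)
  also have "\<dots> = (B * A - 1\<^sub>m n) * (B - C)"
    using A B C CA by (simp add: minus_mult_distrib_mat)
  also have "\<dots> = B * A * (B - C) - (B - C)"
    using minus_mult_distrib_mat[OF mult_carrier_mat[OF B A] one_carrier_mat BC]
    by (simp add: left_mult_one_mat[OF BC])
  also have "B * A * (B - C) = B * A * B - B * (A * C)"
    using A B C dims by (simp add: mult_minus_distrib_mat[of _ n n] mat_mult_assoc_dim)
  finally have first: "mat_adjoint (B - C) * A * (B - C) = B * A * B - B - (B - C)"
    using AC B by simp
  have "mat_adjoint (G * V) * D * (G * V)
      = mat_adjoint (G * V) * F * (G * V) - mat_adjoint (G * V) * (V * A * mat_adjoint V) * (G * V)"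
    unfolding D_def mult_minus_distrib_mat[OF GV' F VAV]
    by (rule minus_mult_distrib_mat[OF mult_carrier_mat[OF GV' F] mult_carrier_mat[OF GV' VAV] GV])
  also have "mat_adjoint (G * V) * F * (G * V) = B"
    using dims by (simp add: B_def G_adj mat_mult_assoc_dim mat_inverse_cancel[OF FG])
  also have "mat_adjoint (G * V) * (V * A * mat_adjoint V) * (G * V) = B * A * B"
    using dims by (simp add: B_def G_adj mat_mult_assoc_dim)
  finally have second: "mat_adjoint (G * V) * D * (G * V) = B - B * A * B" .
  have BAB: "B * A * B \<in> carrier_mat n n" using A B by simp
  have "C - B = mat_adjoint (B - C) * A * (B - C) + mat_adjoint (G * V) * D * (G * V)"
    unfolding first second using B C BAB by (intro eq_matI) auto
  moreover have "psd_mat n (mat_adjoint (B - C) * A * (B - C))"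
    by (rule psd_mat_congruence[OF A BC A_psd])
  moreover have "psd_mat n (mat_adjoint (G * V) * D * (G * V))"
    using le by (intro psd_mat_congruence[OF D GV]) (simp add: mat_le_iff_psd D_def)
  moreover have "mat_adjoint (B - C) * A * (B - C) \<in> carrier_mat n n"
    by (rule mult_carrier_mat[OF mult_carrier_mat[OF mat_adjoint_carrier[OF BC] A] BC])
  moreover have "mat_adjoint (G * V) * D * (G * V) \<in> carrier_mat n n"
    by (rule mult_carrier_mat[OF mult_carrier_mat[OF GV' D] GV])
  ultimately show ?thesis
    unfolding mat_le_iff_psd B_def[symmetric] by (simp add: psd_mat_add)
qed

section \<open>Unitarily diagonalised matrices\<close>

definition spectral_mat :: "nat \<Rightarrow> complex mat \<Rightarrow> (nat \<Rightarrow> real) \<Rightarrow> complex mat" where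
  "spectral_mat n U d = U * mat_diag n (\<lambda>i. complex_of_real (d i)) * mat_adjoint U"

lemma unitary_matD:
  assumes "unitary_mat n U"
  shows "U \<in> carrier_mat n n" "mat_adjoint U \<in> carrier_mat n n" "dim_row U = n" "dim_col U = n"
    "mat_adjoint U * U = 1\<^sub>m n" "U * mat_adjoint U = 1\<^sub>m n"
  using assms by (auto simp: unitary_mat_def)

lemma spectral_mat_carrier:
  "unitary_mat n U \<Longrightarrow> spectral_mat n U d \<in> carrier_mat n n"
  using unitary_matD[of n U] by (auto simp: spectral_mat_def)

lemma self_adjoint_matD:
  "self_adjoint_mat n h \<Longrightarrow> h \<in> carrier_mat n n" "self_adjoint_mat n h \<Longrightarrow> mat_adjoint h = h"
  by (simp_all add: self_adjoint_mat_def)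

lemma self_adjoint_spectral_mat:
  assumes "unitary_mat n U" shows "self_adjoint_mat n (spectral_mat n U d)"
  using spectral_mat_carrier[OF assms] unitary_matD[OF assms]
  by (auto simp: self_adjoint_mat_def spectral_mat_def mat_mult_assoc_dim)

lemma spectral_mat_mult:
  assumes "unitary_mat n U"
  shows "spectral_mat n U d * spectral_mat n U e = spectral_mat n U (\<lambda>i. d i * e i)"
proof -
  note U = unitary_matD[OF assms]
  have "mat_diag n (\<lambda>i. complex_of_real (d i)) * (mat_diag n (\<lambda>i. complex_of_real (e i)) * mat_adjoint U)
     = mat_diag n (\<lambda>i. complex_of_real (d i * e i)) * mat_adjoint U"
    using U by (simp add: mat_mult_assoc_dim[symmetric])
  then show ?thesis
    using U by (simp add: spectral_mat_def mat_mult_assoc_dim mat_inverse_cancel[OF U(5)])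
qed

lemma spectral_mat_one:
  assumes "unitary_mat n U" shows "spectral_mat n U (\<lambda>i. 1) = 1\<^sub>m n"
  using unitary_matD[OF assms] by (simp add: spectral_mat_def)

lemma psd_spectral_mat:
  assumes U: "unitary_mat n U" and "\<And>i. i < n \<Longrightarrow> 0 \<le> d i"
  shows "psd_mat n (spectral_mat n U d)"
  using psd_mat_congruence[OF mat_diag_dim unitary_matD(2)[OF U] psd_mat_diag[OF assms(2)]]
  by (simp add: spectral_mat_def)

lemma spectral_mat_cong:
  assumes "\<And>i. i < n \<Longrightarrow> d i = e i" shows "spectral_mat n U d = spectral_mat n U e"
proof -
  have "mat_diag n (\<lambda>i. complex_of_real (d i)) = mat_diag n (\<lambda>i. complex_of_real (e i))"
    using assms by (intro eq_matI) (auto simp: mat_diag_def)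
  then show ?thesis by (simp add: spectral_mat_def)
qed

text \<open>
  In the eigenbases, \<open>S\<close> becomes \<open>T = U\<^sup>* S W\<close>, and the intertwining relation says
  \<open>d\<^sub>i T\<^sub>i\<^sub>j = T\<^sub>i\<^sub>j e\<^sub>j\<close>: an entry of \<open>T\<close> vanishes unless it links equal eigenvalues. Such a relation
  survives when \<open>f\<close> is applied to the eigenvalues. Because \<open>S\<close> may be rectangular, this one fact yields
  both the independence of \<open>f(h)\<close> from the diagonalisation (\<open>S = 1\<close>) and that of \<open>p f(php) p\<close> from the
  basis of the range of \<open>p\<close>.
\<close>

lemma spectral_mat_intertwine:
  assumes U: "unitary_mat n U" and W: "unitary_mat m W" and S: "S \<in> carrier_mat n m"
    and eq: "spectral_mat n U d * S = S * spectral_mat m W e"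
  shows "spectral_mat n U (\<lambda>i. f (d i)) * S = S * spectral_mat m W (\<lambda>i. f (e i))"
proof -
  note U' = unitary_matD[OF U] and W' = unitary_matD[OF W]
  note cancel = mat_inverse_cancel[OF U'(5)] mat_inverse_cancel[OF U'(6)]
    mat_inverse_cancel[OF W'(5)] mat_inverse_cancel[OF W'(6)]
  define T where "T = mat_adjoint U * S * W"
  have T: "T \<in> carrier_mat n m"
    unfolding T_def by (rule mult_carrier_mat[OF mult_carrier_mat[OF U'(2) S] W'(1)])
  have conj: "mat_adjoint U * (spectral_mat n U a * S) * W = mat_diag n (\<lambda>i. complex_of_real (a i)) * T"
    "mat_adjoint U * (S * spectral_mat m W b) * W = T * mat_diag m (\<lambda>i. complex_of_real (b i))" for a b
    using U' W' S by (auto simp: T_def spectral_mat_def mat_mult_assoc_dim cancel)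
  have "mat_diag n (\<lambda>i. complex_of_real (d i)) * T = T * mat_diag m (\<lambda>i. complex_of_real (e i))"
    using eq conj by metis
  then have entry: "complex_of_real (d i) * T $$ (i, j) = T $$ (i, j) * complex_of_real (e j)"
    if "i < n" "j < m" for i j
    using that T by (auto simp: mat_diag_mult_left[OF T] mat_diag_mult_right[OF T] dest!: arg_cong[of _ _ "\<lambda>M. M $$ (i, j)"])
  have fentry: "complex_of_real (f (d i)) * T $$ (i, j) = T $$ (i, j) * complex_of_real (f (e j))"
    if "i < n" "j < m" for i j
  proof (cases "T $$ (i, j) = 0")
    case False
    then have "d i = e j" using entry[OF that] by (simp add: mult.commute)
    then show ?thesis by simp
  qed simp
  have "mat_diag n (\<lambda>i. complex_of_real (f (d i))) * T = T * mat_diag m (\<lambda>i. complex_of_real (f (e i)))"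
    using fentry by (intro eq_matI) (auto simp: mat_diag_mult_left[OF T] mat_diag_mult_right[OF T])
  then have "mat_adjoint U * (spectral_mat n U (\<lambda>i. f (d i)) * S) * W
      = mat_adjoint U * (S * spectral_mat m W (\<lambda>i. f (e i))) * W"
    by (simp add: conj)
  then have "U * (mat_adjoint U * (spectral_mat n U (\<lambda>i. f (d i)) * S) * W) * mat_adjoint W
      = U * (mat_adjoint U * (S * spectral_mat m W (\<lambda>i. f (e i))) * W) * mat_adjoint W"
    by simp
  then show ?thesis
    using U' W' S by (simp add: spectral_mat_def mat_mult_assoc_dim cancel)
qed

lemma is_mat_fun_iff:
  assumes "h \<in> carrier_mat n n"
  shows "is_mat_fun f h B \<longleftrightarrow>
    (\<exists>U d. unitary_mat n U \<and> h = spectral_mat n U d \<and> B = spectral_mat n U (\<lambda>i. f (d i)))"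
  using assms by (simp add: is_mat_fun_def spectral_mat_def)

lemma mat_fun_spectral_mat:
  assumes U: "unitary_mat n U"
  shows "mat_fun f (spectral_mat n U d) = spectral_mat n U (\<lambda>i. f (d i))"
  unfolding mat_fun_def is_mat_fun_iff[OF spectral_mat_carrier[OF U]]
proof (rule the_equality)
  show "\<exists>U' d'. unitary_mat n U' \<and> spectral_mat n U d = spectral_mat n U' d'
      \<and> spectral_mat n U (\<lambda>i. f (d i)) = spectral_mat n U' (\<lambda>i. f (d' i))"
    using U by blast
next
  fix B assume "\<exists>U' d'. unitary_mat n U' \<and> spectral_mat n U d = spectral_mat n U' d'
      \<and> B = spectral_mat n U' (\<lambda>i. f (d' i))"
  then obtain U' d' where U': "unitary_mat n U'" and eq: "spectral_mat n U d = spectral_mat n U' d'"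
    and B: "B = spectral_mat n U' (\<lambda>i. f (d' i))" by blast
  note c = spectral_mat_carrier[OF U] spectral_mat_carrier[OF U']
  have "spectral_mat n U (\<lambda>i. f (d i)) * 1\<^sub>m n = 1\<^sub>m n * spectral_mat n U' (\<lambda>i. f (d' i))"
    by (rule spectral_mat_intertwine[OF U U']) (use c eq in \<open>auto simp: right_mult_one_mat[OF c(2)] left_mult_one_mat[OF c(2)]\<close>)
  then show "B = spectral_mat n U (\<lambda>i. f (d i))"
    by (simp add: B right_mult_one_mat[OF c(1)] left_mult_one_mat[OF c(2)])
qed

section \<open>Block diagonal matrices\<close>

definition block_diag :: "complex mat \<Rightarrow> complex mat \<Rightarrow> complex mat" where
  "block_diag A B
    = four_block_mat A (0\<^sub>m (dim_row A) (dim_col B)) (0\<^sub>m (dim_row B) (dim_col A)) B"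

lemma block_diag_carrier:
  "A \<in> carrier_mat n n \<Longrightarrow> B \<in> carrier_mat m m \<Longrightarrow> block_diag A B \<in> carrier_mat (n + m) (n + m)"
  by (simp add: block_diag_def)

lemma block_diag_mult:
  assumes "A \<in> carrier_mat n n" "B \<in> carrier_mat m m" "C \<in> carrier_mat n n" "D \<in> carrier_mat m m"
  shows "block_diag A B * block_diag C D = block_diag (A * C) (B * D)"
proof -
  have "A * C \<in> carrier_mat n n" "B * D \<in> carrier_mat m m" using assms by simp_all
  then show ?thesis
    using assms unfolding block_diag_def
    by (subst mult_four_block_mat[of _ n n _ m _ m _ _ n _ m]) simp_all
qed

lemma mat_adjoint_block_diag:
  assumes "A \<in> carrier_mat n n" "B \<in> carrier_mat m m"
  shows "mat_adjoint (block_diag A B) = block_diag (mat_adjoint A) (mat_adjoint B)"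
  using assms unfolding block_diag_def
  by (subst mat_adjoint_four_block[of _ n n _ m _ m]) simp_all

lemma self_adjoint_block_diag:
  assumes "self_adjoint_mat n A" "self_adjoint_mat m B"
  shows "self_adjoint_mat (n + m) (block_diag A B)"
  using self_adjoint_matD[OF assms(1)] self_adjoint_matD[OF assms(2)]
  by (simp add: self_adjoint_mat_def mat_adjoint_block_diag block_diag_carrier)

lemma unitary_block_diag:
  assumes "unitary_mat n U" "unitary_mat m W"
  shows "unitary_mat (n + m) (block_diag U W)"
proof -
  note U = unitary_matD[OF assms(1)] and W = unitary_matD[OF assms(2)]
  have "block_diag (1\<^sub>m n) (1\<^sub>m m) = 1\<^sub>m (n + m)" by (simp add: block_diag_def)
  then show ?thesis
    unfolding unitary_mat_def mat_adjoint_block_diag[OF U(1) W(1)]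
      block_diag_mult[OF U(1) W(1) U(2) W(2)] block_diag_mult[OF U(2) W(2) U(1) W(1)]
    using block_diag_carrier[OF U(1) W(1)] U W by simp
qed

lemma spectral_mat_block_diag:
  assumes "unitary_mat n U" "unitary_mat m W"
  shows "spectral_mat (n + m) (block_diag U W) (\<lambda>i. if i < n then d i else e (i - n))
    = block_diag (spectral_mat n U d) (spectral_mat m W e)"
proof -
  note U = unitary_matD[OF assms(1)] and W = unitary_matD[OF assms(2)]
  have "mat_diag (n + m) (\<lambda>i. complex_of_real (if i < n then d i else e (i - n)))
      = block_diag (mat_diag n (\<lambda>i. complex_of_real (d i))) (mat_diag m (\<lambda>i. complex_of_real (e i)))"
    by (rule eq_matI) (auto simp: block_diag_def mat_diag_def)
  then show ?thesis
    unfolding spectral_mat_def mat_adjoint_block_diag[OF U(1) W(1)]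
    by (simp add: block_diag_mult[OF U(1) W(1) mat_diag_dim mat_diag_dim]
        block_diag_mult[OF mult_carrier_mat[OF U(1) mat_diag_dim] mult_carrier_mat[OF W(1) mat_diag_dim] U(2) W(2)])
qed

section \<open>The spectral theorem\<close>

text \<open>
  Extending \<open>v\<close> to a basis and applying the Gram-Schmidt process keeps \<open>v\<close> as the first vector; the
  resulting vectors are orthogonal but not normalised, so the columns are divided by their norms.
\<close>

lemma unitary_first_column:
  fixes v :: "complex vec"
  assumes v: "v \<in> carrier_vec n" and v0: "v \<noteq> 0\<^sub>v n"
  shows "\<exists>U c. unitary_mat n U \<and> col U 0 = c \<cdot>\<^sub>v v"
proof -
  have n: "n \<noteq> 0" using v v0 by (metis carrier_vecD eq_vecI index_zero_vec(2) not_less_zero)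
  interpret cof_vec_space n "TYPE(complex)" .
  define b where "b = basis_completion v"
  define ws where "ws = gram_schmidt n b"
  from basis_completion[OF v v0, folded b_def]
  have dist_b: "distinct b" and indep: "\<not> lin_dep (set b)" and b: "set b \<subseteq> carrier_vec n"
    and hdb: "hd b = v" and len_b: "length b = n" by blast+
  obtain vs where bv: "b = v # vs" using hdb len_b n by (cases b) simp_all
  from gram_schmidt_result[OF b dist_b indep refl, folded ws_def]
  have orth: "corthogonal ws" and ws: "set ws \<subseteq> carrier_vec n" and len: "length ws = n"
    by (simp_all add: len_b)
  have "hd ws = v" using gram_schmidt_hd[OF v, of vs, folded bv] by (simp add: ws_def)
  then have ws0: "ws ! 0 = v" using len n by (metis hd_conv_nth length_0_conv)
  have wsc: "ws ! j \<in> carrier_vec n" if "j < n" for j using ws len that by (metis nth_mem subsetD)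
  define r where "r j = sqrt (Re (ws ! j \<bullet>c ws ! j))" for j
  have inner: "ws ! i \<bullet>c ws ! j = (if i = j then complex_of_real (r i * r j) else 0)"
    and r_pos: "r j \<noteq> 0" if "i < n" "j < n" for i j
  proof -
    have "0 \<le> ws ! j \<bullet>c ws ! j" by (rule conjugate_square_ge_0_vec)
    moreover have "ws ! j \<bullet>c ws ! j \<noteq> 0" using corthogonalD[OF orth] len that by simp
    ultimately have ge: "0 < Re (ws ! j \<bullet>c ws ! j)" "Im (ws ! j \<bullet>c ws ! j) = 0"
      by (auto simp: less_eq_complex_def complex_eq_iff)
    then show "r j \<noteq> 0" by (simp add: r_def)
    have "ws ! j \<bullet>c ws ! j = complex_of_real (r j * r j)"
      using ge by (simp add: r_def complex_eq_iff del: of_real_mult)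
    then show "ws ! i \<bullet>c ws ! j = (if i = j then complex_of_real (r i * r j) else 0)"
      using corthogonalD[OF orth, of i j] len that by simp
  qed
  define U where "U = mat n n (\<lambda>(i, j). ws ! j $ i / complex_of_real (r j))"
  have U: "U \<in> carrier_mat n n" by (simp add: U_def)
  have "mat_adjoint U * U = 1\<^sub>m n"
  proof (rule eq_matI)
    fix i j assume "i < dim_row (1\<^sub>m n :: complex mat)" "j < dim_col (1\<^sub>m n :: complex mat)"
    then have ij: "i < n" "j < n" by simp_all
    have "(mat_adjoint U * U) $$ (i, j)
        = (\<Sum>k<n. cnj (ws ! i $ k / complex_of_real (r i)) * (ws ! j $ k / complex_of_real (r j)))"
      using ij by (simp add: U_def scalar_prod_def atLeast0LessThan)
    also have "\<dots> = (\<Sum>k<n. ws ! j $ k * cnj (ws ! i $ k)) / complex_of_real (r j * r i)"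
      by (simp add: sum_divide_distrib mult.commute)
    also have "(\<Sum>k<n. ws ! j $ k * cnj (ws ! i $ k)) = ws ! j \<bullet>c ws ! i"
      using wsc[OF ij(1)] by (simp add: scalar_prod_def atLeast0LessThan)
    finally show "(mat_adjoint U * U) $$ (i, j) = 1\<^sub>m n $$ (i, j)"
      using ij inner[OF ij(2,1)] r_pos[OF ij] by simp
  qed (simp_all add: U_def)
  moreover from this have "U * mat_adjoint U = 1\<^sub>m n"
    using mat_mult_left_right_inverse[OF mat_adjoint_carrier[OF U] U] by simp
  ultimately have "unitary_mat n U" using U by (simp add: unitary_mat_def)
  moreover have "col U 0 = (1 / complex_of_real (r 0)) \<cdot>\<^sub>v v"
    using n v ws0 by (intro eq_vecI) (simp_all add: U_def)
  ultimately show ?thesis by blast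
qed

lemma spectral_mat_unitary_conj:
  assumes "unitary_mat n U" "unitary_mat n P"
  shows "unitary_mat n (U * P)" "spectral_mat n (U * P) d = U * spectral_mat n P d * mat_adjoint U"
proof -
  note U = unitary_matD[OF assms(1)] and P = unitary_matD[OF assms(2)]
  show "unitary_mat n (U * P)"
    using U P by (simp add: unitary_mat_def mat_mult_assoc_dim mat_inverse_cancel[OF U(5)]
        mat_inverse_cancel[OF P(6)])
  show "spectral_mat n (U * P) d = U * spectral_mat n P d * mat_adjoint U"
    using U P by (simp add: spectral_mat_def mat_mult_assoc_dim)
qed

text \<open>
  Deflation. A unitary \<open>U\<close> whose first column is an eigenvector turns \<open>h\<close> into \<open>M = U\<^sup>* h U\<close> with first
  column \<open>(e, 0, \<dots>, 0)\<close>. As \<open>M\<close> is self-adjoint, its first row has the same shape and \<open>e\<close> is real, so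
  \<open>M = (e) \<oplus> L\<close> with \<open>L\<close> self-adjoint of smaller size.
\<close>

lemma spectral_theorem:
  "self_adjoint_mat n h \<Longrightarrow> \<exists>U d. unitary_mat n U \<and> h = spectral_mat n U d"
proof (induction n arbitrary: h)
  case 0
  have U: "unitary_mat 0 (1\<^sub>m 0)" by (simp add: unitary_mat_def)
  have "h \<in> carrier_mat 0 0" using 0 by (simp add: self_adjoint_mat_def)
  then have "h = spectral_mat 0 (1\<^sub>m 0) (\<lambda>_. 0)"
    by (intro eq_matI) (simp_all add: carrier_matD spectral_mat_def)
  then show ?case using U by blast
next
  case (Suc n)
  then have h: "h \<in> carrier_mat (Suc n) (Suc n)" and h_adj: "mat_adjoint h = h"
    by (simp_all add: self_adjoint_mat_def)
  obtain e where "e \<in> spectrum h" using spectrum_non_empty[OF h] by auto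
  then obtain v where v: "v \<in> carrier_vec (Suc n)" "v \<noteq> 0\<^sub>v (Suc n)" "h *\<^sub>v v = e \<cdot>\<^sub>v v"
    using h by (auto simp: spectrum_def eigenvalue_def eigenvector_def)
  obtain U c where U: "unitary_mat (Suc n) U" and col0: "col U 0 = c \<cdot>\<^sub>v v"
    using unitary_first_column[OF v(1,2)] by blast
  note U' = unitary_matD[OF U]
  define M where "M = mat_adjoint U * h * U"
  have M: "M \<in> carrier_mat (Suc n) (Suc n)"
    unfolding M_def by (rule mult_carrier_mat[OF mult_carrier_mat[OF U'(2) h] U'(1)])
  have M_adj: "mat_adjoint M = M"
    using h U' by (simp add: M_def h_adj mat_mult_assoc_dim)
  have hM: "h = U * M * mat_adjoint U"
    using h U' by (simp add: M_def mat_mult_assoc_dim mat_inverse_cancel[OF U'(6)])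
  have "col M 0 = mat_adjoint U *\<^sub>v col (h * U) 0"
    using h U' by (simp add: M_def mat_mult_assoc_dim col_mult2[OF U'(2) mult_carrier_mat[OF h U'(1)]])
  also have "col (h * U) 0 = h *\<^sub>v (c \<cdot>\<^sub>v v)"
    by (simp add: col_mult2[OF h U'(1)] col0)
  also have "\<dots> = e \<cdot>\<^sub>v col U 0"
    using v h by (simp add: mult_mat_vec col0 smult_smult_assoc mult.commute)
  also have "mat_adjoint U *\<^sub>v (e \<cdot>\<^sub>v col U 0) = e \<cdot>\<^sub>v col (mat_adjoint U * U) 0"
    using col_mult2[OF U'(2,1) zero_less_Suc] col_dim[of U 0] unfolding U'(3)
    by (simp only: mult_mat_vec[OF U'(2)])
  finally have colM: "col M 0 = e \<cdot>\<^sub>v unit_vec (Suc n) 0" using U' by simp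
  have M0: "M $$ (i, 0) = (if i = 0 then e else 0)" if "i < Suc n" for i
    using arg_cong[OF colM, of "\<lambda>x. x $ i"] that M by auto
  have M_sym: "M $$ (i, j) = cnj (M $$ (j, i))" if "i < Suc n" "j < Suc n" for i j
    using arg_cong[OF M_adj, of "\<lambda>X. X $$ (i, j)"] that M by simp
  have "e = cnj e" using M_sym[of 0 0] unfolding M0[OF zero_less_Suc] by simp
  then have e_real: "complex_of_real (Re e) = e" by (simp add: complex_eq_iff)
  have M0': "M $$ (0, j) = (if j = 0 then e else 0)" if "j < Suc n" for j
    using M_sym[OF zero_less_Suc that] M0[OF that] \<open>e = cnj e\<close> by (simp split: if_splits)
  define L where "L = mat n n (\<lambda>(i, j). M $$ (Suc i, Suc j))"
  have "mat_adjoint L = L"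
  proof (rule eq_matI)
    fix i j assume "i < dim_row L" "j < dim_col L"
    then have ij: "i < n" "j < n" by (simp_all add: L_def)
    then show "mat_adjoint L $$ (i, j) = L $$ (i, j)"
      using M_sym[of "Suc i" "Suc j"] by (simp add: L_def)
  qed (simp_all add: L_def)
  then have "self_adjoint_mat n L" by (simp add: self_adjoint_mat_def L_def)
  then obtain W d where W: "unitary_mat n W" and L: "L = spectral_mat n W d"
    using Suc.IH by blast
  have one: "unitary_mat 1 (1\<^sub>m 1)" by (simp add: unitary_mat_def)
  define P where "P = block_diag (1\<^sub>m 1) W"
  have P: "unitary_mat (Suc n) P" using unitary_block_diag[OF one W] by (simp add: P_def)
  have E: "spectral_mat 1 (1\<^sub>m 1) (\<lambda>_. Re e) = mat 1 1 (\<lambda>_. e)"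
    by (rule eq_matI) (simp_all add: spectral_mat_def mat_diag_def e_real scalar_prod_def)
  have "M = block_diag (mat 1 1 (\<lambda>_. e)) L"
  proof (rule eq_matI)
    fix i j assume "i < dim_row (block_diag (mat 1 1 (\<lambda>_. e)) L)" "j < dim_col (block_diag (mat 1 1 (\<lambda>_. e)) L)"
    then have ij: "i < Suc n" "j < Suc n" by (simp_all add: block_diag_def L_def)
    show "M $$ (i, j) = block_diag (mat 1 1 (\<lambda>_. e)) L $$ (i, j)"
      using ij M0[of i] M0'[of j] by (cases i; cases j) (simp_all add: block_diag_def L_def)
  qed (use M in \<open>simp_all add: block_diag_def L_def\<close>)
  also have "\<dots> = block_diag (spectral_mat 1 (1\<^sub>m 1) (\<lambda>_. Re e)) L" by (simp only: E)
  also have "\<dots> = spectral_mat (Suc n) P (\<lambda>i. if i < 1 then Re e else d (i - 1))"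
    using spectral_mat_block_diag[OF one W, of "\<lambda>_. Re e" d] by (simp add: P_def L)
  finally show ?case
    using spectral_mat_unitary_conj[OF U P] hM by metis
qed

section \<open>Functional calculus and compressions\<close>

lemma self_adjoint_mat_fun:
  assumes "self_adjoint_mat n h" shows "self_adjoint_mat n (mat_fun f h)"
  using spectral_theorem[OF assms] by (metis mat_fun_spectral_mat self_adjoint_spectral_mat)

lemma self_adjoint_congruence:
  assumes "self_adjoint_mat n h" "V \<in> carrier_mat n k"
  shows "self_adjoint_mat k (mat_adjoint V * h * V)"
proof -
  note h = self_adjoint_matD[OF assms(1)]
  have "mat_adjoint V * h * V \<in> carrier_mat k k"
    by (rule mult_carrier_mat[OF mult_carrier_mat[OF mat_adjoint_carrier[OF assms(2)] h(1)] assms(2)])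
  then show ?thesis
    using h assms(2) by (simp add: self_adjoint_mat_def mat_mult_assoc_dim)
qed

lemma mat_fun_intertwine:
  assumes X: "self_adjoint_mat n X" and Y: "self_adjoint_mat m Y" and S: "S \<in> carrier_mat n m"
    and eq: "X * S = S * Y"
  shows "mat_fun f X * S = S * mat_fun f Y"
proof -
  obtain U d where U: "unitary_mat n U" "X = spectral_mat n U d" using spectral_theorem[OF X] by blast
  obtain W e where W: "unitary_mat m W" "Y = spectral_mat m W e" using spectral_theorem[OF Y] by blast
  show ?thesis
    using spectral_mat_intertwine[OF U(1) W(1) S] eq
    by (simp add: U W mat_fun_spectral_mat[OF U(1)] mat_fun_spectral_mat[OF W(1)])
qed

lemma mat_fun_uminus:
  assumes "self_adjoint_mat n h"
  shows "mat_fun (\<lambda>x. - g x) h = - mat_fun g h"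
proof -
  obtain U d where U: "unitary_mat n U" and h: "h = spectral_mat n U d"
    using spectral_theorem[OF assms] by blast
  note U' = unitary_matD[OF U]
  have "mat_diag n (\<lambda>i. complex_of_real (- g (d i))) = - mat_diag n (\<lambda>i. complex_of_real (g (d i)))"
    by (rule eq_matI) (simp_all add: mat_diag_def)
  then have "spectral_mat n U (\<lambda>i. - g (d i)) = - spectral_mat n U (\<lambda>i. g (d i))"
    using U' by (simp add: spectral_mat_def)
  then show ?thesis by (simp only: h mat_fun_spectral_mat[OF U])
qed

lemma mat_fun_block_diag:
  assumes "self_adjoint_mat n A" "self_adjoint_mat m B"
  shows "mat_fun f (block_diag A B) = block_diag (mat_fun f A) (mat_fun f B)"
proof -
  obtain U d where U: "unitary_mat n U" "A = spectral_mat n U d" using spectral_theorem[OF assms(1)] by blast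
  obtain W e where W: "unitary_mat m W" "B = spectral_mat m W e" using spectral_theorem[OF assms(2)] by blast
  have "f (if i < n then d i else e (i - n)) = (if i < n then f (d i) else f (e (i - n)))" for i
    by simp
  then show ?thesis
    using mat_fun_spectral_mat[OF unitary_block_diag[OF U(1) W(1)], of f "\<lambda>i. if i < n then d i else e (i - n)"]
    by (simp only: spectral_mat_block_diag[OF U(1) W(1), of d e]
        spectral_mat_block_diag[OF U(1) W(1), of "\<lambda>i. f (d i)" "\<lambda>i. f (e i)"] U(2) W(2)
        mat_fun_spectral_mat[OF U(1)] mat_fun_spectral_mat[OF W(1)])
qed

lemma projection_mat_isometry:
  assumes V: "V \<in> carrier_mat n k" and iso: "mat_adjoint V * V = 1\<^sub>m k"
  shows "projection_mat n (V * mat_adjoint V)"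
proof -
  have "V * mat_adjoint V \<in> carrier_mat n n" by (rule mult_carrier_mat[OF V mat_adjoint_carrier[OF V]])
  then show ?thesis
    using V by (simp add: projection_mat_def self_adjoint_mat_def mat_mult_assoc_dim mat_inverse_cancel[OF iso])
qed

text \<open>
  If \<open>V\<close> and \<open>W\<close> are isometries with the same range projection, then \<open>S = W\<^sup>* V\<close> satisfies \<open>W S = V\<close> and
  \<open>S V\<^sup>* = W\<^sup>*\<close>, and it intertwines the two compressions of \<open>h\<close>. Hence
  \<open>W f(W\<^sup>* h W) W\<^sup>* = W f(W\<^sup>* h W) S V\<^sup>* = W S f(V\<^sup>* h V) V\<^sup>* = V f(V\<^sup>* h V) V\<^sup>*\<close>.
\<close>

lemma compressed_fun_isometry:
  assumes h: "self_adjoint_mat n h" and V: "V \<in> carrier_mat n k" and iso: "mat_adjoint V * V = 1\<^sub>m k"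
  shows "compressed_fun f (V * mat_adjoint V) h = V * mat_fun f (mat_adjoint V * h * V) * mat_adjoint V"
  unfolding compressed_fun_def
proof (rule the_equality)
  show "is_compressed_fun f (V * mat_adjoint V) h (V * mat_fun f (mat_adjoint V * h * V) * mat_adjoint V)"
    using V iso unfolding is_compressed_fun_def by (intro exI[of _ k] exI[of _ V]) simp
next
  fix B assume "is_compressed_fun f (V * mat_adjoint V) h B"
  then obtain l W where W: "W \<in> carrier_mat n l" "mat_adjoint W * W = 1\<^sub>m l"
      "W * mat_adjoint W = V * mat_adjoint V"
    and B: "B = W * mat_fun f (mat_adjoint W * h * W) * mat_adjoint W"
    using V unfolding is_compressed_fun_def by auto
  define S where "S = mat_adjoint W * V"
  have S: "S \<in> carrier_mat l k" unfolding S_def by (rule mult_carrier_mat[OF mat_adjoint_carrier[OF W(1)] V])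
  note dims = carrier_matD[OF V] carrier_matD[OF W(1)] carrier_matD[OF self_adjoint_matD(1)[OF h]]
  let ?X = "mat_adjoint W * h * W" and ?Y = "mat_adjoint V * h * V"
  note X = self_adjoint_congruence[OF h W(1)] and Y = self_adjoint_congruence[OF h V]
  note fX = self_adjoint_matD(1)[OF self_adjoint_mat_fun[OF X, of f]]
    and fY = self_adjoint_matD(1)[OF self_adjoint_mat_fun[OF Y, of f]]
  have WS: "W * S = V"
  proof -
    have "W * S = W * mat_adjoint W * V" using dims by (simp add: S_def mat_mult_assoc_dim)
    also have "\<dots> = V * (mat_adjoint V * V)" using dims by (simp add: W(3) mat_mult_assoc_dim)
    finally show ?thesis using V by (simp add: iso)
  qed
  have SV: "S * mat_adjoint V = mat_adjoint W"
  proof -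
    have "S * mat_adjoint V = mat_adjoint W * (W * mat_adjoint W)"
      using dims by (simp add: S_def W(3) mat_mult_assoc_dim)
    also have "\<dots> = mat_adjoint W"
      using dims by (simp add: mat_inverse_cancel[OF W(2)])
    finally show ?thesis .
  qed
  have "?X * S = mat_adjoint W * h * (W * S)" using dims by (simp add: S_def mat_mult_assoc_dim)
  also have "\<dots> = S * mat_adjoint V * (h * V)" using dims by (simp add: WS SV mat_mult_assoc_dim)
  also have "\<dots> = S * ?Y" using dims carrier_matD[OF S] by (simp add: mat_mult_assoc_dim)
  finally have inter: "mat_fun f ?X * S = S * mat_fun f ?Y" by (rule mat_fun_intertwine[OF X Y S])
  have "B = W * (mat_fun f ?X * S) * mat_adjoint V"
    using dims carrier_matD[OF S] carrier_matD[OF fX] by (simp add: B SV[symmetric] mat_mult_assoc_dim)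
  also have "\<dots> = W * S * mat_fun f ?Y * mat_adjoint V"
    using dims carrier_matD[OF S] carrier_matD[OF fY] by (simp only: inter) (simp add: mat_mult_assoc_dim)
  finally show "B = V * mat_fun f ?Y * mat_adjoint V" by (simp only: WS)
qed

section \<open>Spectra\<close>

lemma spectrum_spectral_mat:
  assumes U: "unitary_mat n U"
  shows "spectrum (spectral_mat n U d) = (\<lambda>i. complex_of_real (d i)) ` {..<n}"
proof -
  let ?D = "mat_diag n (\<lambda>i. complex_of_real (d i))"
  note U' = unitary_matD[OF U]
  have "similar_mat (spectral_mat n U d) ?D"
    unfolding similar_mat_def
    using similar_mat_witI[OF U'(6,5) _ spectral_mat_carrier[OF U] mat_diag_dim U'(1,2), of d]
    by (auto simp: spectral_mat_def)
  then have "char_poly (spectral_mat n U d) = char_poly ?D" by (rule char_poly_similar)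
  also have "\<dots> = (\<Prod>a\<leftarrow>diag_mat ?D. [:- a, 1:])"
    by (rule char_poly_upper_triangular[OF mat_diag_dim]) (simp add: upper_triangular_def mat_diag_def)
  also have "diag_mat ?D = map (\<lambda>i. complex_of_real (d i)) [0..<n]"
    by (simp add: diag_mat_def mat_diag_def)
  finally show ?thesis
    unfolding spectrum_root_char_poly[OF spectral_mat_carrier[OF U]]
    by (auto simp: poly_prod_list prod_list_zero_iff)
qed

lemma spectrum_in_spectral_mat:
  assumes "unitary_mat n U"
  shows "spectrum_in (spectral_mat n U d) I \<longleftrightarrow> (\<forall>i<n. d i \<in> I)"
  unfolding spectrum_in_def spectrum_spectral_mat[OF assms] by (auto simp: image_iff subset_iff)

lemma mat_fun_mult_inverse:
  assumes "self_adjoint_mat n h" "spectrum_in h I" "\<And>x. x \<in> I \<Longrightarrow> f x \<noteq> 0"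
  shows "mat_fun f h * mat_fun (\<lambda>x. 1 / f x) h = 1\<^sub>m n"
proof -
  obtain U d where U: "unitary_mat n U" and h: "h = spectral_mat n U d"
    using spectral_theorem[OF assms(1)] by blast
  have "d i \<in> I" if "i < n" for i
    using assms(2) that unfolding h spectrum_in_spectral_mat[OF U] by blast
  then have "spectral_mat n U (\<lambda>i. f (d i) * (1 / f (d i))) = spectral_mat n U (\<lambda>i. 1)"
    using assms(3) by (intro spectral_mat_cong) simp
  then show ?thesis
    by (simp only: h mat_fun_spectral_mat[OF U] spectral_mat_mult[OF U] spectral_mat_one[OF U])
qed

lemma psd_mat_fun:
  assumes "self_adjoint_mat n h" "spectrum_in h I" "\<And>x. x \<in> I \<Longrightarrow> 0 \<le> f x"
  shows "psd_mat n (mat_fun f h)"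
proof -
  obtain U d where U: "unitary_mat n U" and h: "h = spectral_mat n U d"
    using spectral_theorem[OF assms(1)] by blast
  have "d i \<in> I" if "i < n" for i
    using assms(2) that unfolding h spectrum_in_spectral_mat[OF U] by blast
  then show ?thesis
    unfolding h mat_fun_spectral_mat[OF U] using assms(3) by (intro psd_spectral_mat[OF U]) blast
qed

lemma spectrum_in_block_diag:
  assumes "self_adjoint_mat n A" "self_adjoint_mat m B" "spectrum_in A I" "spectrum_in B I"
  shows "spectrum_in (block_diag A B) I"
proof -
  obtain U d where U: "unitary_mat n U" "A = spectral_mat n U d" using spectral_theorem[OF assms(1)] by blast
  obtain W e where W: "unitary_mat m W" "B = spectral_mat m W e" using spectral_theorem[OF assms(2)] by blast
  have "\<forall>i<n. d i \<in> I" "\<forall>i<m. e i \<in> I"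
    using assms(3,4) unfolding U(2) W(2) spectrum_in_spectral_mat[OF U(1)] spectrum_in_spectral_mat[OF W(1)]
    by blast+
  then show ?thesis
    unfolding U(2) W(2) spectral_mat_block_diag[OF U(1) W(1), symmetric]
      spectrum_in_spectral_mat[OF unitary_block_diag[OF U(1) W(1)]]
    by (metis add_diff_inverse_nat nat_add_left_cancel_less)
qed

text \<open>
  If \<open>T\<close> is \<open>V\<close> written in eigenbases of \<open>h\<close> and of the compression, then the eigenvalues \<open>e\<^sub>j\<close> of the
  compression are \<open>\<Sum>i. |T\<^sub>i\<^sub>j|\<^sup>2 d\<^sub>i\<close>, where the \<open>d\<^sub>i\<close> are the eigenvalues of \<open>h\<close>. The weights sum to \<open>1\<close>
  because \<open>T\<close> is again an isometry, so \<open>e\<^sub>j\<close> lies in the convex set \<open>I\<close>.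
\<close>

lemma spectrum_in_compression:
  assumes I: "is_interval I" and h: "self_adjoint_mat n h" and spec: "spectrum_in h I"
    and V: "V \<in> carrier_mat n k" and iso: "mat_adjoint V * V = 1\<^sub>m k"
  shows "spectrum_in (mat_adjoint V * h * V) I"
proof -
  obtain U d where U: "unitary_mat n U" and hU: "h = spectral_mat n U d"
    using spectral_theorem[OF h] by blast
  obtain W e where W: "unitary_mat k W" and comp: "mat_adjoint V * h * V = spectral_mat k W e"
    using spectral_theorem[OF self_adjoint_congruence[OF h V]] by blast
  note U' = unitary_matD[OF U] and W' = unitary_matD[OF W]
  note cancel = mat_inverse_cancel[OF U'(6)] mat_inverse_cancel[OF W'(5)] mat_inverse_cancel[OF iso]
  note dims = carrier_matD[OF V] U'(3,4) W'(3,4)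
  have d: "d i \<in> I" if "i < n" for i
    using spec that unfolding hU spectrum_in_spectral_mat[OF U] by blast
  define T where "T = mat_adjoint U * V * W"
  have T: "T \<in> carrier_mat n k"
    unfolding T_def by (rule mult_carrier_mat[OF mult_carrier_mat[OF U'(2) V] W'(1)])
  have T_iso: "mat_adjoint T * T = 1\<^sub>m k"
    using dims by (simp add: T_def mat_mult_assoc_dim cancel W'(5))
  have "mat_diag k (\<lambda>i. complex_of_real (e i)) = mat_adjoint W * spectral_mat k W e * W"
    using dims by (simp add: spectral_mat_def mat_mult_assoc_dim cancel W'(5))
  also have "\<dots> = mat_adjoint T * (mat_diag n (\<lambda>i. complex_of_real (d i)) * T)"
    using dims unfolding comp[symmetric] hU by (simp add: T_def spectral_mat_def mat_mult_assoc_dim)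
  finally have diag: "mat_diag k (\<lambda>i. complex_of_real (e i))
      = mat_adjoint T * (mat_diag n (\<lambda>i. complex_of_real (d i)) * T)" .
  have "e j \<in> I" if j: "j < k" for j
  proof -
    \<comment> \<open>stated with a real weight \<open>a\<close> so that \<open>a = 1\<close> also gives the sum of the weights\<close>
    have sq: "cnj z * (complex_of_real a * z) = complex_of_real ((cmod z)\<^sup>2 * a)" for a z
      by (simp only: of_real_mult complex_norm_square mult.assoc mult.commute mult.left_commute)
    have "complex_of_real (e j) = (\<Sum>i<n. cnj (T $$ (i, j)) * (complex_of_real (d i) * T $$ (i, j)))"
      using arg_cong[OF diag, of "\<lambda>X. X $$ (j, j)"] j T
      by (simp add: mat_diag_mult_left[OF T] scalar_prod_def atLeast0LessThan) (simp add: mat_diag_def)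
    also have "\<dots> = complex_of_real (\<Sum>i<n. (cmod (T $$ (i, j)))\<^sup>2 * d i)"
      by (simp only: sq of_real_sum)
    finally have e: "e j = (\<Sum>i<n. (cmod (T $$ (i, j)))\<^sup>2 * d i)"
      by (simp only: of_real_eq_iff)
    have "1 = (\<Sum>i<n. cnj (T $$ (i, j)) * (complex_of_real 1 * T $$ (i, j)))"
      using arg_cong[OF T_iso, of "\<lambda>X. X $$ (j, j)"] j T
      by (simp add: scalar_prod_def atLeast0LessThan)
    also have "\<dots> = complex_of_real (\<Sum>i<n. (cmod (T $$ (i, j)))\<^sup>2)"
      by (simp only: sq of_real_sum mult_1_right)
    finally have "(\<Sum>i<n. (cmod (T $$ (i, j)))\<^sup>2) = 1"
      by (metis of_real_eq_1_iff)
    then show ?thesis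
      using convex_sum[of "{..<n}" I "\<lambda>i. (cmod (T $$ (i, j)))\<^sup>2" d] I d
      by (simp add: e is_interval_convex)
  qed
  then show ?thesis unfolding comp spectrum_in_spectral_mat[OF W] by blast
qed

section \<open>Convex combinations as compressions\<close>

text \<open>
  The map \<open>v \<mapsto> (\<surd>t v, \<surd>(1 - t) v)\<close>. The two blocks without columns serve only to stack the other two
  blocks on top of each other.
\<close>

definition convex_isometry :: "nat \<Rightarrow> real \<Rightarrow> complex mat" where
  "convex_isometry n t = four_block_mat
     (complex_of_real (sqrt t) \<cdot>\<^sub>m 1\<^sub>m n) (0\<^sub>m n 0)
     (complex_of_real (sqrt (1 - t)) \<cdot>\<^sub>m 1\<^sub>m n) (0\<^sub>m n 0)"

lemma convex_isometry_carrier: "convex_isometry n t \<in> carrier_mat (n + n) n"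
  unfolding convex_isometry_def carrier_mat_def by simp

lemma convex_isometry_compression:
  assumes A: "A \<in> carrier_mat n n" and B: "B \<in> carrier_mat n n" and t: "0 \<le> t" "t \<le> 1"
  shows "mat_adjoint (convex_isometry n t) * block_diag A B * convex_isometry n t
    = complex_of_real t \<cdot>\<^sub>m A + complex_of_real (1 - t) \<cdot>\<^sub>m B"
proof -
  let ?r = "complex_of_real (sqrt t)" and ?s = "complex_of_real (sqrt (1 - t))"
  let ?Z = "0\<^sub>m n 0" and ?Z' = "0\<^sub>m 0 n" and ?O = "0\<^sub>m n n"
  have sq: "?r * ?r = complex_of_real t" "?s * ?s = complex_of_real (1 - t)"
    using t by (simp_all flip: of_real_mult)
  have adj: "mat_adjoint (convex_isometry n t) = four_block_mat (?r \<cdot>\<^sub>m 1\<^sub>m n) (?s \<cdot>\<^sub>m 1\<^sub>m n) ?Z' ?Z'"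
    unfolding convex_isometry_def by (subst mat_adjoint_four_block[of _ n n _ 0 _ n]) simp_all
  have bd: "block_diag A B = four_block_mat A ?O ?O B" using A B by (simp add: block_diag_def)
  have "mat_adjoint (convex_isometry n t) * block_diag A B
      = four_block_mat (?r \<cdot>\<^sub>m A) (?s \<cdot>\<^sub>m B) ?Z' ?Z'"
    unfolding adj bd using A B
    by (subst mult_four_block_mat[of _ n n _ n _ 0 _ _ n _ n])
      (simp_all add: mult_smult_assoc_mat[OF one_carrier_mat])
  also have "\<dots> * convex_isometry n t
      = four_block_mat (?r \<cdot>\<^sub>m (?r \<cdot>\<^sub>m A) + ?s \<cdot>\<^sub>m (?s \<cdot>\<^sub>m B)) ?Z ?Z' (0\<^sub>m 0 0)"
    unfolding convex_isometry_def using A B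
    by (subst mult_four_block_mat[of _ n n _ n _ 0 _ _ n _ 0])
      (simp_all add: mult_smult_distrib[OF smult_carrier_mat[OF A] one_carrier_mat]
        mult_smult_distrib[OF smult_carrier_mat[OF B] one_carrier_mat])
  also have "\<dots> = complex_of_real t \<cdot>\<^sub>m A + complex_of_real (1 - t) \<cdot>\<^sub>m B"
    using A B by (intro eq_matI) (simp_all add: sq mult.assoc[symmetric])
  finally show ?thesis .
qed

text \<open>
  This is the case \<open>A = B = 1\<close> of the compression formula.
\<close>

lemma convex_isometry_isometry:
  assumes "0 \<le> t" "t \<le> 1"
  shows "mat_adjoint (convex_isometry n t) * convex_isometry n t = 1\<^sub>m n"
proof -
  have "block_diag (1\<^sub>m n) (1\<^sub>m n) = 1\<^sub>m (n + n)" by (simp add: block_diag_def)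
  then have "mat_adjoint (convex_isometry n t) * convex_isometry n t
      = mat_adjoint (convex_isometry n t) * block_diag (1\<^sub>m n) (1\<^sub>m n) * convex_isometry n t"
    using right_mult_one_mat[OF mat_adjoint_carrier[OF convex_isometry_carrier]] by simp
  also have "\<dots> = complex_of_real t \<cdot>\<^sub>m 1\<^sub>m n + complex_of_real (1 - t) \<cdot>\<^sub>m 1\<^sub>m n"
    by (rule convex_isometry_compression[OF one_carrier_mat one_carrier_mat assms])
  also have "\<dots> = 1\<^sub>m n" by (rule eq_matI) simp_all
  finally show ?thesis .
qed

theorem lemma0p1:
  fixes I :: "real set" and f :: "real \<Rightarrow> real"
  assumes "is_interval I" and "\<exists>a\<in>I. \<exists>b\<in>I. a < b"
    and "continuous_on I f"
    and "\<And>x. x \<in> I \<Longrightarrow> f x > 0"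
    and "\<And>n p h. projection_mat n p \<Longrightarrow> self_adjoint_mat n h \<Longrightarrow> spectrum_in h I \<Longrightarrow>
           mat_le n (compressed_fun f p h) (mat_fun f h)"
  shows "operator_convex_on I (\<lambda>x. - 1 / f x)"
  unfolding operator_convex_on_def
proof (intro conjI allI impI; (elim conjE)?)
  show "continuous_on I (\<lambda>x. - 1 / f x)"
    using assms(3,4) by (intro continuous_intros) force+
next
  fix n h\<^sub>1 h\<^sub>2 and t :: real
  assume t: "0 \<le> t" "t \<le> 1"
    and h1: "self_adjoint_mat n h\<^sub>1" "spectrum_in h\<^sub>1 I"
    and h2: "self_adjoint_mat n h\<^sub>2" "spectrum_in h\<^sub>2 I"
  have f_nz: "f x \<noteq> 0" if "x \<in> I" for x using assms(4)[OF that] by simp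
  define h where "h = block_diag h\<^sub>1 h\<^sub>2"
  define V where "V = convex_isometry n t"
  define k where "k = complex_of_real t \<cdot>\<^sub>m h\<^sub>1 + complex_of_real (1 - t) \<cdot>\<^sub>m h\<^sub>2"
  let ?g = "\<lambda>x. 1 / f x"
  have V: "V \<in> carrier_mat (n + n) n" and iso: "mat_adjoint V * V = 1\<^sub>m n"
    unfolding V_def by (rule convex_isometry_carrier, rule convex_isometry_isometry[OF t])
  have h: "self_adjoint_mat (n + n) h" and spec_h: "spectrum_in h I"
    unfolding h_def
    by (rule self_adjoint_block_diag[OF h1(1) h2(1)],
        rule spectrum_in_block_diag[OF h1(1) h2(1) h1(2) h2(2)])
  have k: "k = mat_adjoint V * h * V"
    unfolding k_def h_def V_def
    by (rule convex_isometry_compression[OF self_adjoint_matD(1)[OF h1(1)] self_adjoint_matD(1)[OF h2(1)] t, symmetric])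
  have k_adj: "self_adjoint_mat n k" unfolding k by (rule self_adjoint_congruence[OF h V])
  have spec_k: "spectrum_in k I" unfolding k by (rule spectrum_in_compression[OF assms(1) h spec_h V iso])
  have "mat_le (n + n) (V * mat_fun f k * mat_adjoint V) (mat_fun f h)"
    using assms(5)[OF projection_mat_isometry[OF V iso] h spec_h]
    unfolding compressed_fun_isometry[OF h V iso] k .
  \<comment> \<open>\<open>(1/f)(h)\<close> and \<open>(1/f)(k)\<close> are the inverses of \<open>f(h)\<close> and \<open>f(k)\<close>\<close>
  moreover have "mat_fun f h * mat_fun ?g h = 1\<^sub>m (n + n)"
    by (rule mat_fun_mult_inverse[OF h spec_h f_nz])
  moreover have "mat_fun f k * mat_fun ?g k = 1\<^sub>m n"
    by (rule mat_fun_mult_inverse[OF k_adj spec_k f_nz])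
  moreover have "psd_mat n (mat_fun f k)"
    by (rule psd_mat_fun[OF k_adj spec_k less_imp_le[OF assms(4)]])
  ultimately have le: "mat_le n (mat_adjoint V * mat_fun ?g h * V) (mat_fun ?g k)"
    using mat_le_inverse_compression[OF V] self_adjoint_matD[OF self_adjoint_mat_fun[OF h]]
      self_adjoint_matD[OF self_adjoint_mat_fun[OF k_adj]]
    by blast
  note g1 = self_adjoint_matD(1)[OF self_adjoint_mat_fun[OF h1(1), of ?g]]
    and g2 = self_adjoint_matD(1)[OF self_adjoint_mat_fun[OF h2(1), of ?g]]
    and gk = self_adjoint_matD(1)[OF self_adjoint_mat_fun[OF k_adj, of ?g]]
  have comb: "mat_adjoint V * mat_fun ?g h * V
      = complex_of_real t \<cdot>\<^sub>m mat_fun ?g h\<^sub>1 + complex_of_real (1 - t) \<cdot>\<^sub>m mat_fun ?g h\<^sub>2"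
    unfolding h_def V_def mat_fun_block_diag[OF h1(1) h2(1)] by (rule convex_isometry_compression[OF g1 g2 t])
  \<comment> \<open>the two minus signs exchange the sides of \<open>le\<close>\<close>
  have neg: "mat_fun (\<lambda>x. - 1 / f x) x = - mat_fun ?g x" if "self_adjoint_mat n x" for x
    using mat_fun_uminus[OF that, of ?g] by simp
  have "(complex_of_real t \<cdot>\<^sub>m (- mat_fun ?g h\<^sub>1) + complex_of_real (1 - t) \<cdot>\<^sub>m (- mat_fun ?g h\<^sub>2)) - (- mat_fun ?g k)
      = mat_fun ?g k - (complex_of_real t \<cdot>\<^sub>m mat_fun ?g h\<^sub>1 + complex_of_real (1 - t) \<cdot>\<^sub>m mat_fun ?g h\<^sub>2)"
    using carrier_matD[OF g1] carrier_matD[OF g2] carrier_matD[OF gk] by (intro eq_matI) simp_all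
  then show "mat_le n (mat_fun (\<lambda>x. - 1 / f x) (complex_of_real t \<cdot>\<^sub>m h\<^sub>1 + complex_of_real (1 - t) \<cdot>\<^sub>m h\<^sub>2))
     (complex_of_real t \<cdot>\<^sub>m mat_fun (\<lambda>x. - 1 / f x) h\<^sub>1 + complex_of_real (1 - t) \<cdot>\<^sub>m mat_fun (\<lambda>x. - 1 / f x) h\<^sub>2)"
    using le unfolding comb k_def[symmetric] neg[OF h1(1)] neg[OF h2(1)] neg[OF k_adj] mat_le_iff_psd
    by simp
qed

end
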